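(* Consider the random triangle removal process on $n$ vertices. Suppose that for some fixed $0<\epsilon<\frac16$, all co-degrees satisfy $Y_{u,v}=(1+o(1))np^2$ throughout the times with $p\ge p_0=n^{-1/2+\epsilon}$. Then with high probability the final number of edges (the number of edges of the triangle-free graph at which the process terminates) is at least $n^{3/2-6\epsilon-o(1)}$.
   Context: Random triangle removal process: $G(0)=K_n$ on vertex set $V_G$, $|V_G|=n$; as long as $G(i)$ has a triangle, $G(i+1)$ is obtained by deleting the three edges of a uniformly random triangle of $G(i)$; the process terminates when the graph is triangle-free. $p=p(i)=1-6i/n^2$. For distinct vertices $u,v$, $Y_{u,v}$ is their co-degree in $G(i)$. Asymptotic notation refers to $n\to\infty$; "with high probability" means with probability tending to $1$. *)

theory Defs
  imports "HOL-Probability.Probability"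
begin

type_synonym graph = "nat set set"   (* set of edges, each edge a 2-element set *)

definition complete_graph :: "nat \<Rightarrow> graph" where
  "complete_graph n = {e. \<exists>u<n. \<exists>v<n. u \<noteq> v \<and> e = {u, v}}"

definition triangles :: "graph \<Rightarrow> nat set set" where
  "triangles G = {T. card T = 3 \<and> (\<forall>x\<in>T. \<forall>y\<in>T. x \<noteq> y \<longrightarrow> {x, y} \<in> G)}"

definition remove_triangle :: "nat set \<Rightarrow> graph \<Rightarrow> graph" where
  "remove_triangle T G = G - {{x, y} | x y. x \<in> T \<and> y \<in> T \<and> x \<noteq> y}"

primrec removal_path :: "nat \<Rightarrow> graph \<Rightarrow> graph list pmf" where
  "removal_path 0 G = return_pmf [G]"
| "removal_path (Suc k) G =
     (if triangles G = {} then return_pmf [G]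
      else bind_pmf (pmf_of_set (triangles G))
             (\<lambda>T. map_pmf (Cons G) (removal_path k (remove_triangle T G))))"

(* the full process on K_n; n^2 steps suffice since each step removes 3 edges *)
definition triangle_process :: "nat \<Rightarrow> graph list pmf" where
  "triangle_process n = removal_path (n^2) (complete_graph n)"

definition codeg :: "nat \<Rightarrow> graph \<Rightarrow> nat \<Rightarrow> nat \<Rightarrow> nat" where
  "codeg n G u v = card {w. w < n \<and> {u, w} \<in> G \<and> {v, w} \<in> G}"

definition pt :: "nat \<Rightarrow> nat \<Rightarrow> real" where
  "pt n i = 1 - 6 * real i / (real n)^2"

end

theory Submission
  imports Defs
begin

text \<open>
  Only first moments are needed. Once \<open>p\<close> has dropped to \<open>p\<^sub>0\<close>, every co-degree stays below some
  \<open>D = O(n powr (2 \<epsilon>))\<close>. Call an edge free if it lies in no triangle (such an edge survives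
  forever), and call a triangle isolated if it shares no edge with another one. Let \<open>E\<close>, \<open>Q\<close>,
  \<open>f\<close>, \<open>I\<close> count edges, triangles, free edges and isolated triangles.

  By Cauchy-Schwarz one step lowers \<open>Q\<close> by at least \<open>9 Q / E - 2\<close> on average, while \<open>E\<close> drops by
  exactly 3; hence \<open>Q - E / 3\<close> decays on average like \<open>E\<^sup>3\<close> and is \<open>o(E)\<close> once \<open>E\<close> is about
  \<open>n powr (3/2 - \<epsilon>)\<close>. At that time the deterministic inequality \<open>7 E \<le> 7 f + 3 I + 18 Q\<close> forces
  \<open>f\<close> or \<open>I\<close> to be of order \<open>E\<close>. On the other hand, whenever deleting some triangle would isolate
  a triangle, deleting a neighbouring one would free an edge, and this correspondence is at most
  \<open>3 D\<close> to one; so \<open>I - 3 D f\<close> is a supermartingale, and few free edges would mean few isolated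
  triangles. Markov's inequality for a combination of the two supermartingales, stopped when \<open>f\<close>
  reaches \<open>n powr (3/2 - 6 \<epsilon>)\<close>, concludes.
\<close>

subsection \<open>Free edges and isolated triangles\<close>

definition tdeg :: "graph \<Rightarrow> nat set \<Rightarrow> nat" where
  "tdeg G e = card {T \<in> triangles G. e \<subseteq> T}"

definition free_edges :: "graph \<Rightarrow> graph" where
  "free_edges G = {e \<in> G. tdeg G e = 0}"

definition isolated_triangles :: "graph \<Rightarrow> nat set set" where
  "isolated_triangles G = {T \<in> triangles G. \<forall>e\<in>G. e \<subseteq> T \<longrightarrow> tdeg G e = 1}"

text \<open>These are exactly the triangles destroyed when the edges of \<open>T\<close> are
  deleted; a triangle \<open>T\<close> is its own neighbour.\<close>

definition nbr_triangles :: "graph \<Rightarrow> nat set \<Rightarrow> nat set set" where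
  "nbr_triangles G T = {S \<in> triangles G. \<exists>e\<in>G. e \<subseteq> S \<and> e \<subseteq> T}"

definition newly_free :: "graph \<Rightarrow> nat set \<Rightarrow> graph" where
  "newly_free G T = free_edges (remove_triangle T G) - free_edges G"

definition newly_isolated :: "graph \<Rightarrow> nat set \<Rightarrow> nat set set" where
  "newly_isolated G T = isolated_triangles (remove_triangle T G) - isolated_triangles G"

section \<open>Triangles of a simple graph and the effect of deleting one\<close>

locale simple_graph =
  fixes G :: graph
  assumes finite_graph: "finite G" and card_edge: "e \<in> G \<Longrightarrow> card e = 2"
begin

lemma triangles_iff: "T \<in> triangles G \<longleftrightarrow> card T = 3 \<and> (\<forall>e. e \<subseteq> T \<and> card e = 2 \<longrightarrow> e \<in> G)"
proof -
  have "{x, y} \<in> G" if "\<forall>e. e \<subseteq> T \<and> card e = 2 \<longrightarrow> e \<in> G" "x \<in> T" "y \<in> T" "x \<noteq> y" for x y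
    using that by simp
  moreover have "e \<in> G" if "\<forall>x\<in>T. \<forall>y\<in>T. x \<noteq> y \<longrightarrow> {x, y} \<in> G" "e \<subseteq> T" "card e = 2" for e
    using that by (metis card_2_iff insert_subset)
  ultimately show ?thesis unfolding triangles_def mem_Collect_eq by metis
qed

lemma triangle_card: "T \<in> triangles G \<Longrightarrow> card T = 3"
  by (simp add: triangles_def)

lemma finite_triangle: "T \<in> triangles G \<Longrightarrow> finite T"
  by (rule card_ge_0_finite) (simp add: triangles_def)

lemma finite_edge: "e \<in> G \<Longrightarrow> finite e"
  by (rule card_ge_0_finite) (simp add: card_edge)

lemma triangle_edge: "T \<in> triangles G \<Longrightarrow> x \<in> T \<Longrightarrow> y \<in> T \<Longrightarrow> x \<noteq> y \<Longrightarrow> {x, y} \<in> G"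
  by (simp add: triangles_def)

lemma finite_triangles: "finite (triangles G)"
proof (rule finite_subset)
  show "triangles G \<subseteq> Pow (\<Union>G)"
  proof
    fix T assume T: "T \<in> triangles G"
    show "T \<in> Pow (\<Union>G)"
    proof
      show "T \<subseteq> \<Union>G"
      proof
        fix x assume x: "x \<in> T"
        have "T \<noteq> {x}" using triangle_card[OF T] by auto
        then obtain y where "y \<in> T" "y \<noteq> x" using x by blast
        then show "x \<in> \<Union>G" using triangle_edge[OF T x, of y] by blast
      qed
    qed
  qed
  show "finite (Pow (\<Union>G))" using finite_graph finite_edge by auto
qed

lemma remove_triangle_eq: "remove_triangle T G = {e \<in> G. \<not> e \<subseteq> T}"
proof -
  have "e \<in> {{x, y} | x y. x \<in> T \<and> y \<in> T \<and> x \<noteq> y} \<longleftrightarrow> e \<subseteq> T" if e: "e \<in> G" for e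
  proof -
    obtain u v where "e = {u, v}" "u \<noteq> v"
      using card_edge[OF e] unfolding card_2_iff by blast
    then show ?thesis by blast
  qed
  then show ?thesis unfolding remove_triangle_def by blast
qed

lemma simple_graph_remove: "simple_graph (remove_triangle T G)"
  using finite_graph card_edge by unfold_locales (auto simp: remove_triangle_eq)

lemma triangles_remove: "triangles (remove_triangle T G) = triangles G - nbr_triangles G T"
proof -
  have "S \<in> triangles (remove_triangle T G) \<longleftrightarrow> S \<in> triangles G \<and> \<not> (\<exists>e\<in>G. e \<subseteq> S \<and> e \<subseteq> T)" for S
  proof -
    have "e \<in> remove_triangle T G \<longleftrightarrow> e \<in> G \<and> \<not> e \<subseteq> T" for e
      by (simp add: remove_triangle_eq)
    then show ?thesis
      unfolding simple_graph.triangles_iff[OF simple_graph_remove] triangles_iff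
      using card_edge by blast
  qed
  then show ?thesis by (auto simp: nbr_triangles_def)
qed

lemma nbr_triangles_subset: "nbr_triangles G T \<subseteq> triangles G"
  by (auto simp: nbr_triangles_def)

lemma tdeg_remove_le: "tdeg (remove_triangle T G) e \<le> tdeg G e"
  unfolding tdeg_def using finite_triangles by (intro card_mono) (auto simp: triangles_remove)

lemma edges_of_triangle:
  assumes "T \<in> triangles G" shows "{e \<in> G. e \<subseteq> T} = {e. e \<subseteq> T \<and> card e = 2}"
  using assms card_edge unfolding triangles_iff by auto

lemma card_edges_of_triangle: "T \<in> triangles G \<Longrightarrow> card {e \<in> G. e \<subseteq> T} = 3"
  using n_subsets[of T 2] triangle_card[of T] finite_triangle[of T]
  by (simp add: edges_of_triangle choose_two)

lemma card_remove_triangle: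
  assumes "T \<in> triangles G" shows "card (remove_triangle T G) + 3 = card G"
proof -
  have "G = remove_triangle T G \<union> {e \<in> G. e \<subseteq> T}" by (auto simp: remove_triangle_eq)
  then have "card G = card (remove_triangle T G) + card {e \<in> G. e \<subseteq> T}"
    by (metis (no_types, lifting) card_Un_disjoint disjoint_iff finite_Un finite_graph mem_Collect_eq remove_triangle_eq)
  then show ?thesis using card_edges_of_triangle[OF assms] by simp
qed

section \<open>Edge degrees and the average loss of triangles\<close>

lemma sum_tdeg_mult:
  fixes g :: "nat set \<Rightarrow> real"
  shows "(\<Sum>e\<in>G. real (tdeg G e) * g e) = (\<Sum>T\<in>triangles G. \<Sum>e\<in>{e \<in> G. e \<subseteq> T}. g e)"
proof -
  have "(\<Sum>e\<in>G. real (tdeg G e) * g e) = (\<Sum>e\<in>G. \<Sum>T\<in>{T \<in> triangles G. e \<subseteq> T}. g e)"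
    by (simp add: tdeg_def)
  also have "\<dots> = (\<Sum>T\<in>triangles G. \<Sum>e\<in>{e \<in> G. e \<subseteq> T}. g e)"
    by (rule sum.swap_restrict[OF finite_graph finite_triangles])
  finally show ?thesis .
qed

lemma sum_tdeg: "(\<Sum>e\<in>G. real (tdeg G e)) = 3 * card (triangles G)"
proof -
  have "(\<Sum>e\<in>G. real (tdeg G e)) = (\<Sum>T\<in>triangles G. \<Sum>e\<in>{e \<in> G. e \<subseteq> T}. 1)"
    using sum_tdeg_mult[of "\<lambda>_. 1"] by simp
  also have "\<dots> = (\<Sum>T\<in>triangles G. 3)"
    by (rule sum.cong) (auto simp: card_edges_of_triangle)
  finally show ?thesis by simp
qed

lemma tdeg_pos:
  assumes "T \<in> triangles G" "e \<subseteq> T" shows "tdeg G e > 0"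
  using assms finite_triangles by (auto simp: tdeg_def card_gt_0_iff)

lemma tdeg_one_unique:
  assumes "tdeg G e = 1" "S \<in> triangles G" "T \<in> triangles G" "e \<subseteq> S" "e \<subseteq> T" shows "S = T"
proof -
  obtain U where "{T \<in> triangles G. e \<subseteq> T} = {U}"
    using assms(1) unfolding tdeg_def by (meson card_1_singletonE)
  moreover have "S \<in> {T \<in> triangles G. e \<subseteq> T}" "T \<in> {T \<in> triangles G. e \<subseteq> T}"
    using assms by simp_all
  ultimately show ?thesis by (metis singletonD)
qed

text \<open>Two distinct edges span at least three vertices, so they determine the triangle
  containing both.\<close>

lemma triangles_eq_if_two_edges:
  assumes "S \<in> triangles G" "T \<in> triangles G" "e \<in> G" "d \<in> G" "e \<noteq> d"
    "e \<subseteq> T" "d \<subseteq> T" "e \<subseteq> S" "d \<subseteq> S"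
  shows "S = T"
proof -
  have fin: "finite S" "finite T"
    using assms finite_triangle by auto
  have fe: "finite e" "finite d" using assms(6,7) fin finite_subset by blast+
  have "card (e \<union> d) \<ge> 3"
  proof (rule ccontr)
    assume "\<not> ?thesis"
    then have "card (e \<union> d) \<le> card e" "card (e \<union> d) \<le> card d" using card_edge assms by auto
    then have "e \<union> d = e" "e \<union> d = d"
      using fe by (metis Un_upper1 Un_upper2 card_seteq finite_UnI)+
    then show False using assms by auto
  qed
  then have "e \<union> d = S" "e \<union> d = T"
    using assms fin triangle_card[OF assms(1)] triangle_card[OF assms(2)]
    by (metis Un_least card_seteq)+
  then show ?thesis by simp
qed

lemma nbr_triangles_UN: "nbr_triangles G T = (\<Union>e\<in>{e \<in> G. e \<subseteq> T}. {S \<in> triangles G. e \<subseteq> S})"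
  by (auto simp: nbr_triangles_def)

text \<open>Apart from \<open>T\<close>, the neighbours through different edges of \<open>T\<close>
  are different triangles. The degree sum counts \<open>T\<close> three times instead of once, hence
  the 2.\<close>

lemma card_nbr_triangles:
  assumes T: "T \<in> triangles G"
  shows "real (card (nbr_triangles G T)) = (\<Sum>e\<in>{e \<in> G. e \<subseteq> T}. real (tdeg G e)) - 2"
proof -
  let ?E = "{e \<in> G. e \<subseteq> T}" and ?A = "\<lambda>e. {S \<in> triangles G. e \<subseteq> S}"
  have fE: "finite ?E" using finite_graph by simp
  have ne: "\<exists>e. e \<in> ?E" using card_edges_of_triangle[OF T]
    by (metis card.empty ex_in_conv zero_neq_numeral)
  have fin: "finite (nbr_triangles G T)" using finite_triangles by (simp add: nbr_triangles_def)
  have Tin: "T \<in> nbr_triangles G T" using ne T by (auto simp: nbr_triangles_def)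
  have "nbr_triangles G T - {T} = (\<Union>e\<in>?E. ?A e - {T})" unfolding nbr_triangles_UN by blast
  also have "card \<dots> = (\<Sum>e\<in>?E. card (?A e - {T}))"
  proof (rule card_UN_disjoint)
    show "\<forall>e\<in>?E. \<forall>d\<in>?E. e \<noteq> d \<longrightarrow> (?A e - {T}) \<inter> (?A d - {T}) = {}"
      using triangles_eq_if_two_edges[OF _ T] by blast
  qed (use fE finite_triangles in auto)
  also have "real \<dots> = (\<Sum>e\<in>?E. real (tdeg G e) - 1)"
    unfolding of_nat_sum
  proof (rule sum.cong)
    fix e assume e: "e \<in> ?E"
    then have "card (?A e - {T}) = tdeg G e - 1" using T by (simp add: tdeg_def)
    moreover have "tdeg G e > 0" using tdeg_pos T e by auto
    ultimately show "real (card (?A e - {T})) = real (tdeg G e) - 1" by simp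
  qed simp
  also have "\<dots> = (\<Sum>e\<in>?E. real (tdeg G e)) - 3"
    using card_edges_of_triangle[OF T] by (simp add: sum_subtractf)
  finally have "real (card (nbr_triangles G T - {T})) = (\<Sum>e\<in>?E. real (tdeg G e)) - 3" .
  moreover have "card (nbr_triangles G T) = card (nbr_triangles G T - {T}) + 1"
    using Tin fin by (metis Suc_eq_plus1 card.remove)
  ultimately show ?thesis by simp
qed

lemma card_nbr_triangles_le:
  fixes D :: real
  assumes "T \<in> triangles G" "\<And>e. e \<in> G \<Longrightarrow> tdeg G e \<le> D"
  shows "card (nbr_triangles G T) \<le> 3 * D"
proof -
  have "(\<Sum>e\<in>{e \<in> G. e \<subseteq> T}. real (tdeg G e)) \<le> card {e \<in> G. e \<subseteq> T} * D"
    using assms(2) by (intro sum_bounded_above) auto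
  then show ?thesis using card_nbr_triangles[OF assms(1)] card_edges_of_triangle[OF assms(1)] by simp
qed

text \<open>Swapping the order of summation turns the total loss into the sum of the squared
  degrees. Cauchy-Schwarz bounds that sum below by \<open>(3 Q)^2 / E\<close>, since the degrees add
  up to \<open>3 Q\<close>.\<close>

lemma sum_card_triangles_remove:
  assumes "card G > 0"
  shows "(\<Sum>T\<in>triangles G. real (card (triangles (remove_triangle T G))))
    \<le> card (triangles G) * (card (triangles G) + 2 - 9 * card (triangles G) / card G)"
proof -
  let ?Q = "real (card (triangles G))"
  have "real (card (triangles (remove_triangle T G))) = ?Q + 2 - (\<Sum>e\<in>{e \<in> G. e \<subseteq> T}. real (tdeg G e))"
    if "T \<in> triangles G" for T
  proof -
    have "card (triangles (remove_triangle T G)) = card (triangles G) - card (nbr_triangles G T)"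
      using nbr_triangles_subset finite_triangles
      by (auto simp: triangles_remove intro: card_Diff_subset finite_subset)
    moreover have "card (nbr_triangles G T) \<le> card (triangles G)"
      by (intro card_mono finite_triangles nbr_triangles_subset)
    ultimately show ?thesis using card_nbr_triangles[OF that] by (simp add: of_nat_diff)
  qed
  then have "(\<Sum>T\<in>triangles G. real (card (triangles (remove_triangle T G))))
      = ?Q * (?Q + 2) - (\<Sum>T\<in>triangles G. \<Sum>e\<in>{e \<in> G. e \<subseteq> T}. real (tdeg G e))"
    by (simp add: sum_subtractf)
  also have "\<dots> = ?Q * (?Q + 2) - (\<Sum>e\<in>G. (real (tdeg G e))\<^sup>2)"
    by (simp add: sum_tdeg_mult[symmetric] power2_eq_square)
  finally have *: "(\<Sum>T\<in>triangles G. real (card (triangles (remove_triangle T G))))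
      = ?Q * (?Q + 2) - (\<Sum>e\<in>G. (real (tdeg G e))\<^sup>2)" .
  have "(\<Sum>e\<in>G. real (tdeg G e))\<^sup>2 \<le> card G * (\<Sum>e\<in>G. (real (tdeg G e))\<^sup>2)"
    using Cauchy_Schwarz_ineq_sum[of "\<lambda>_. 1" "\<lambda>e. real (tdeg G e)" G] by simp
  then have "9 * ?Q\<^sup>2 / card G \<le> (\<Sum>e\<in>G. (real (tdeg G e))\<^sup>2)"
    using assms by (simp add: sum_tdeg power2_eq_square field_simps)
  then show ?thesis unfolding * by (simp add: algebra_simps power2_eq_square)
qed

section \<open>Few triangles force free edges or isolated triangles\<close>

lemma card_graph_minus_free_le: "real (card G) - card (free_edges G) \<le> 3 * card (triangles G)"
proof -
  have "real (card G) - card (free_edges G) = real (card (G - free_edges G))"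
    using finite_graph
    by (subst card_Diff_subset) (auto simp: free_edges_def of_nat_diff card_mono)
  also have "\<dots> = (\<Sum>e\<in>G - free_edges G. 1)" by simp
  also have "\<dots> \<le> (\<Sum>e\<in>G - free_edges G. real (tdeg G e))"
    by (intro sum_mono) (auto simp: free_edges_def)
  also have "\<dots> \<le> (\<Sum>e\<in>G. real (tdeg G e))"
    using finite_graph by (intro sum_mono2) auto
  finally show ?thesis by (simp add: sum_tdeg)
qed

text \<open>A triangle that is not isolated contains an edge of degree at least 2, so the degrees of
  such edges bound the number of these triangles.\<close>

lemma card_nonisolated_le:
  "real (card (triangles G - isolated_triangles G))
     \<le> 6 * real (card (triangles G)) - 2 * real (card G) + 2 * real (card (free_edges G))"
proof -
  let ?H = "{e \<in> G. tdeg G e \<ge> 2}"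
  have sub: "triangles G - isolated_triangles G \<subseteq> (\<Union>e\<in>?H. {T \<in> triangles G. e \<subseteq> T})"
  proof
    fix T assume T: "T \<in> triangles G - isolated_triangles G"
    then obtain e where e: "e \<in> G" "e \<subseteq> T" "tdeg G e \<noteq> 1" by (auto simp: isolated_triangles_def)
    moreover have "tdeg G e > 0" using tdeg_pos e T by auto
    ultimately show "T \<in> (\<Union>e\<in>?H. {T \<in> triangles G. e \<subseteq> T})" using T by auto
  qed
  have "card (triangles G - isolated_triangles G) \<le> card (\<Union>e\<in>?H. {T \<in> triangles G. e \<subseteq> T})"
    using sub finite_graph finite_triangles by (intro card_mono) auto
  also have "\<dots> \<le> (\<Sum>e\<in>?H. tdeg G e)"
    unfolding tdeg_def using finite_graph by (intro card_UN_le) auto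
  finally have "real (card (triangles G - isolated_triangles G)) \<le> (\<Sum>e\<in>?H. real (tdeg G e))"
    by (simp flip: of_nat_sum)
  \<comment> \<open>Here \<open>t <= 2 t - 2\<close> because \<open>t >= 2\<close>. The correction
    for degree 0 makes every summand nonnegative, so that the sum may be extended to all
    edges.\<close>
  also have "\<dots> \<le> (\<Sum>e\<in>?H. 2 * real (tdeg G e) - 2 + (if tdeg G e = 0 then 2 else 0))"
    by (intro sum_mono) auto
  also have "\<dots> \<le> (\<Sum>e\<in>G. 2 * real (tdeg G e) - 2 + (if tdeg G e = 0 then 2 else 0))"
    using finite_graph by (intro sum_mono2) auto
  also have "\<dots> = 6 * real (card (triangles G)) - 2 * real (card G) + 2 * real (card (free_edges G))"
    using finite_graph
    by (simp add: sum.distrib sum_subtractf sum_tdeg free_edges_def sum.If_cases Int_def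
        flip: sum_distrib_left)
  finally show ?thesis .
qed

text \<open>This is three times the bound on non-isolated triangles plus the bound on non-free
  edges. Rewritten as \<open>E <= 7 f + 3 I + 18 (Q - E / 3)\<close>, it supplies the coefficients
  of the potential.\<close>

lemma card_graph_le_free_isolated:
  "7 * real (card G) \<le> 7 * card (free_edges G) + 3 * card (isolated_triangles G) + 18 * card (triangles G)"
proof -
  have "isolated_triangles G \<subseteq> triangles G" by (auto simp: isolated_triangles_def)
  then have "card (triangles G) = card (isolated_triangles G) + card (triangles G - isolated_triangles G)"
    using finite_triangles
    by (metis add.commute card_Diff_subset card_mono finite_subset le_add_diff_inverse2)
  then show ?thesis using card_graph_minus_free_le card_nonisolated_le by simp
qed

section \<open>Edges freed against triangles isolated in one step\<close>

lemma free_edges_mono: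
  assumes "T \<in> triangles G" shows "free_edges G \<subseteq> free_edges (remove_triangle T G)"
proof
  fix e assume "e \<in> free_edges G"
  then have e: "e \<in> G" "tdeg G e = 0" by (auto simp: free_edges_def)
  then have "\<not> e \<subseteq> T" using tdeg_pos[OF assms, of e] by auto
  then show "e \<in> free_edges (remove_triangle T G)"
    using e tdeg_remove_le[of T e] by (auto simp: free_edges_def remove_triangle_eq)
qed

text \<open>If deleting \<open>T2\<close> isolates \<open>T\<close>, then \<open>T2\<close> destroys some \<open>T'\<close> that meets \<open>T\<close> in an
  edge. Deleting \<open>T'\<close> instead of \<open>T2\<close> would have freed the edge of \<open>T\<close> that avoids \<open>T2\<close>.\<close>

lemma newly_isolated_imp_newly_free:
  assumes T2: "T2 \<in> triangles G" and T: "T \<in> newly_isolated G T2"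
  obtains T' e where "T' \<in> triangles G" "T2 \<in> nbr_triangles G T'" "e \<in> newly_free G T'"
    "tdeg G e = 1" "e \<subseteq> T" "T \<in> triangles G"
proof -
  interpret R: simple_graph "remove_triangle T2 G" by (rule simple_graph_remove)
  have T_R: "T \<in> triangles (remove_triangle T2 G)"
    and iso: "\<And>e. e \<in> remove_triangle T2 G \<Longrightarrow> e \<subseteq> T \<Longrightarrow> tdeg (remove_triangle T2 G) e = 1"
    and niso: "T \<notin> isolated_triangles G"
    using T by (auto simp: newly_isolated_def isolated_triangles_def)
  have TG: "T \<in> triangles G" and nsh: "\<And>e. e \<in> G \<Longrightarrow> e \<subseteq> T \<Longrightarrow> \<not> e \<subseteq> T2"
    using T_R by (auto simp: triangles_remove nbr_triangles_def)
  obtain e0 where e0: "e0 \<in> G" "e0 \<subseteq> T" "tdeg G e0 \<noteq> 1"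
    using niso TG by (auto simp: isolated_triangles_def)
  have "{T \<in> triangles G. e0 \<subseteq> T} \<noteq> {T}" using e0(3) by (auto simp: tdeg_def)
  then obtain T' where T': "T' \<in> triangles G" "e0 \<subseteq> T'" "T' \<noteq> T" using TG e0(2) by blast
  have e0R: "e0 \<in> remove_triangle T2 G" using e0 nsh by (auto simp: remove_triangle_eq)
  \<comment> \<open>After the deletion \<open>T\<close> is the only triangle on \<open>e0\<close>,
    so the other triangle \<open>T'\<close> on \<open>e0\<close> must have been destroyed through an
    edge \<open>e1\<close> shared with \<open>T2\<close>.\<close>
  have "T' \<notin> triangles (remove_triangle T2 G)"
    using R.tdeg_one_unique[OF iso[OF e0R e0(2)] _ T_R] T' e0 by auto
  then obtain e1 where e1: "e1 \<in> G" "e1 \<subseteq> T'" "e1 \<subseteq> T2"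
    using T' by (auto simp: triangles_remove nbr_triangles_def)
  \<comment> \<open>The edge \<open>e1\<close> does not lie in \<open>T\<close>, which survives.
    Thus \<open>x\<close> is the vertex of \<open>T'\<close> outside \<open>T\<close>, and the other
    end \<open>a\<close> of \<open>e1\<close> lies in \<open>e0\<close>.\<close>
  obtain x where x: "x \<in> e1" "x \<notin> T"
    using nsh e1 by blast
  have x': "x \<notin> e0" using x e0 by auto
  have cT': "card T' = 3" using triangle_card T' by auto
  have fT': "finite T'" using T' finite_triangle by auto
  have "card (insert x e0) = 3" using card_edge[OF e0(1)] x' finite_edge[OF e0(1)] by simp
  then have T'eq: "T' = insert x e0"
    using fT' cT' T' x e1 by (metis card_seteq in_mono insert_subset le_refl)
  obtain a where a: "a \<in> e1" "a \<noteq> x"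
    using card_edge[OF e1(1)] by (metis card_2_iff insertI1 insert_commute)
  have ae0: "a \<in> e0" using a e1 T'eq by auto
  obtain u v where "e0 = {u, v}" "u \<noteq> v"
    using card_edge[OF e0(1)] unfolding card_2_iff by blast
  then obtain b where b: "b \<noteq> a" "e0 = {a, b}"
    using ae0 by (metis insertE insert_commute singletonD)
  have abT: "a \<in> T" "b \<in> T" using b e0 by auto
  have fT: "finite T" using TG finite_triangle by auto
  have "card (T - {a, b}) = 1"
    using triangle_card[OF TG] abT b fT by (simp add: card_Diff_subset)
  then obtain c where c: "T - {a, b} = {c}" by (auto simp: card_1_singleton_iff)
  then have Teq: "T = {a, b, c}" "c \<noteq> a" "c \<noteq> b" using abT by auto
  have aT2: "a \<in> T2" "x \<in> T2" using a x e1 by auto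
  \<comment> \<open>\<open>T2\<close> contains \<open>a\<close>. If it also contained
    \<open>b\<close> or \<open>c\<close>, it would share an edge with \<open>T\<close>.\<close>
  have bT2: "b \<notin> T2" using nsh[of "{a,b}"] e0 b aT2 by auto
  have acG: "{a, c} \<in> G" and bcG: "{b, c} \<in> G" using triangle_edge[OF TG] Teq by auto
  have cT2: "c \<notin> T2" using nsh[OF acG] aT2 Teq by auto
  have bcR: "{b, c} \<in> remove_triangle T2 G" using bcG bT2 by (auto simp: remove_triangle_eq)
  \<comment> \<open>A triangle on \<open>b\<close> and \<open>c\<close> has at most one vertex in
    \<open>T2\<close>, hence it survives the deletion of \<open>T2\<close>, after which
    \<open>T\<close> is the only triangle on that edge.\<close>
  have uniq: "S = T" if S: "S \<in> triangles G" "{b, c} \<subseteq> S" for S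
  proof -
    have "S \<notin> nbr_triangles G T2"
    proof
      assume "S \<in> nbr_triangles G T2"
      then obtain e2 where e2: "e2 \<in> G" "e2 \<subseteq> S" "e2 \<subseteq> T2" by (auto simp: nbr_triangles_def)
      have fS: "finite S" using S finite_triangle by auto
      have "e2 \<subseteq> S - {b, c}" using e2 bT2 cT2 by auto
      then have "card e2 \<le> card (S - {b, c})" using fS by (intro card_mono) auto
      also have "\<dots> = 1" using S fS triangle_card[OF S(1)] Teq by (simp add: card_Diff_subset)
      finally show False using card_edge[OF e2(1)] by simp
    qed
    then have "S \<in> triangles (remove_triangle T2 G)" using S by (simp add: triangles_remove)
    then show ?thesis using R.tdeg_one_unique[OF iso[OF bcR] _ T_R] S Teq by auto
  qed
  have bcT: "{b, c} \<subseteq> T" using Teq(1) by simp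
  have "{S \<in> triangles G. {b, c} \<subseteq> S} = {T}" using uniq TG bcT by blast
  then have t1: "tdeg G {b, c} = 1" by (simp add: tdeg_def)
  \<comment> \<open>\<open>T'\<close> consists of \<open>x\<close>, \<open>a\<close> and
    \<open>b\<close>. Deleting it spares the edge from \<open>b\<close> to \<open>c\<close> but
    destroys \<open>T\<close>, the only triangle on that edge.\<close>
  have "c \<notin> T'" using T'eq b(2) Teq(2,3) x(2) bcT by auto
  then have "{b, c} \<in> remove_triangle T' G" using bcG by (auto simp: remove_triangle_eq)
  moreover have "tdeg (remove_triangle T' G) {b, c} = 0"
  proof -
    have "T \<in> nbr_triangles G T'" using TG T' e0 by (auto simp: nbr_triangles_def)
    then have "{S \<in> triangles (remove_triangle T' G). {b, c} \<subseteq> S} = {}"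
      using uniq by (auto simp: triangles_remove)
    then show ?thesis by (simp only: tdeg_def card.empty)
  qed
  ultimately have "{b, c} \<in> newly_free G T'"
    using t1 by (simp add: newly_free_def free_edges_def)
  moreover have "T2 \<in> nbr_triangles G T'" using T2 e1 by (auto simp: nbr_triangles_def)
  ultimately show ?thesis using that[OF T'(1)] t1 bcT TG by blast
qed

lemma finite_newly_free: "finite (newly_free G T)"
  using finite_graph by (auto simp: newly_free_def free_edges_def remove_triangle_eq)

lemma finite_isolated_triangles: "finite (isolated_triangles G)"
  using finite_triangles by (simp add: isolated_triangles_def)

lemma finite_newly_isolated: "finite (newly_isolated G T)"
  using simple_graph.finite_isolated_triangles[OF simple_graph_remove] by (simp add: newly_isolated_def)

text \<open>Each pair of a deleted \<open>T2\<close> and a triangle \<open>T\<close> isolated by it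
  is charged to a pair of a deleted \<open>T'\<close> and an edge \<open>e\<close> freed by it.
  Given the latter, \<open>T2\<close> is one of at most \<open>3 D\<close> neighbours of
  \<open>T'\<close>, and \<open>e\<close> determines \<open>T\<close> because its degree is
  1.\<close>

lemma sum_newly_isolated_le:
  fixes D :: real
  assumes D: "\<And>e. e \<in> G \<Longrightarrow> tdeg G e \<le> D" "D \<ge> 0"
  shows "(\<Sum>T\<in>triangles G. real (card (newly_isolated G T)))
    \<le> 3 * D * (\<Sum>T\<in>triangles G. real (card (newly_free G T)))"
proof -
  let ?P = "Sigma (triangles G) (newly_isolated G)"
  let ?Z = "{(T', e) \<in> Sigma (triangles G) (newly_free G). tdeg G e = 1}"
  let ?R = "\<lambda>(T', e). nbr_triangles G T' \<times> {T \<in> triangles G. e \<subseteq> T}"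
  have finZ: "finite (Sigma (triangles G) (newly_free G))"
    using finite_triangles finite_newly_free by (intro finite_SigmaI)
  then have finZ1: "finite ?Z" by (rule finite_subset[rotated]) auto
  have finR: "finite (?R z)" for z
    using finite_triangles nbr_triangles_subset by (auto intro: finite_subset split: prod.splits)
  have "?P \<subseteq> (\<Union>z\<in>?Z. ?R z)"
  proof
    fix z assume "z \<in> ?P"
    then obtain T2 T where z: "z = (T2, T)" "T2 \<in> triangles G" "T \<in> newly_isolated G T2" by auto
    obtain T' e where *: "T' \<in> triangles G" "T2 \<in> nbr_triangles G T'" "e \<in> newly_free G T'"
      "tdeg G e = 1" "e \<subseteq> T" "T \<in> triangles G"
      using newly_isolated_imp_newly_free[OF z(2,3)] .
    then have "(T', e) \<in> ?Z" "z \<in> ?R (T', e)" using z by auto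
    then show "z \<in> (\<Union>z\<in>?Z. ?R z)" by blast
  qed
  then have "card ?P \<le> card (\<Union>z\<in>?Z. ?R z)"
    using finZ1 finR by (intro card_mono) auto
  also have "\<dots> \<le> (\<Sum>z\<in>?Z. card (?R z))" by (rule card_UN_le[OF finZ1])
  finally have "real (card ?P) \<le> (\<Sum>z\<in>?Z. real (card (?R z)))" by (simp flip: of_nat_sum)
  also have "\<dots> \<le> (\<Sum>z\<in>?Z. 3 * D)"
  proof (rule sum_mono)
    fix z assume "z \<in> ?Z"
    then obtain T' e where z: "z = (T', e)" "T' \<in> triangles G" "tdeg G e = 1" by auto
    then show "real (card (?R z)) \<le> 3 * D"
      using card_nbr_triangles_le[OF z(2) D(1)] by (simp add: card_cartesian_product flip: tdeg_def)
  qed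
  also have "\<dots> \<le> (\<Sum>z\<in>Sigma (triangles G) (newly_free G). 3 * D)"
    using finZ D(2) by (intro sum_mono2) auto
  also have "\<dots> = 3 * D * real (card (Sigma (triangles G) (newly_free G)))" by simp
  finally show ?thesis
    using finite_triangles finite_newly_free finite_newly_isolated by (simp add: card_SigmaI)
qed

lemma card_free_edges_remove:
  assumes "T \<in> triangles G"
  shows "card (free_edges (remove_triangle T G)) = card (free_edges G) + card (newly_free G T)"
proof -
  have "free_edges (remove_triangle T G) = free_edges G \<union> newly_free G T"
    using free_edges_mono[OF assms] by (auto simp: newly_free_def)
  moreover have "finite (free_edges G)" using finite_graph by (simp add: free_edges_def)
  moreover have "free_edges G \<inter> newly_free G T = {}" by (auto simp: newly_free_def)
  ultimately show ?thesis using finite_newly_free by (simp add: card_Un_disjoint)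
qed

text \<open>Only an upper bound, since \<open>T\<close> may itself be isolated and is then
  lost.\<close>

lemma card_isolated_triangles_remove:
  "card (isolated_triangles (remove_triangle T G)) \<le> card (isolated_triangles G) + card (newly_isolated G T)"
proof -
  have "isolated_triangles (remove_triangle T G) \<subseteq> isolated_triangles G \<union> newly_isolated G T"
    by (auto simp: newly_isolated_def)
  then show ?thesis
    using finite_newly_isolated finite_isolated_triangles
    by (meson card_Un_le card_mono finite_UnI le_trans)
qed

text \<open>A freed edge lies in a destroyed triangle, which shares an edge with \<open>T\<close>.
  Two disjoint edges would give that triangle four vertices.\<close>

lemma newly_free_meets:
  assumes "e \<in> newly_free G T" shows "e \<inter> T \<noteq> {}"
proof
  assume disj: "e \<inter> T = {}"
  have e: "e \<in> G" "tdeg G e \<noteq> 0" "tdeg (remove_triangle T G) e = 0"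
    using assms by (auto simp: newly_free_def free_edges_def remove_triangle_eq)
  have "{S \<in> triangles G. e \<subseteq> S} \<noteq> {}" using e(2) by (metis card.empty tdeg_def)
  then obtain S where S: "S \<in> triangles G" "e \<subseteq> S" by auto
  have "S \<notin> triangles (remove_triangle T G)"
    using simple_graph.tdeg_pos[OF simple_graph_remove, of S T e] e S by auto
  then obtain d where d: "d \<in> G" "d \<subseteq> S" "d \<subseteq> T"
    using S by (auto simp: triangles_remove nbr_triangles_def)
  have "finite S" using S finite_triangle by auto
  have fin: "finite e" "finite d" using finite_edge e d by auto
  have "card (e \<union> d) = 4" using card_edge[OF d(1)] card_edge[OF e(1)] fin disj d
    by (subst card_Un_disjoint) auto
  moreover have "card (e \<union> d) \<le> card S" using \<open>finite S\<close> S d by (intro card_mono) auto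
  ultimately show False using triangle_card[OF S(1)] by simp
qed

end

lemma simple_graph_complete: "G \<subseteq> complete_graph n \<Longrightarrow> simple_graph G"
proof
  assume G: "G \<subseteq> complete_graph n"
  have "complete_graph n \<subseteq> Pow {..<n}" by (auto simp: complete_graph_def)
  then show "finite G" using G by (meson finite_Pow_iff finite_lessThan finite_subset)
  show "card e = 2" if "e \<in> G" for e using that G by (auto simp: complete_graph_def)
qed

text \<open>Every freed edge has one of its ends among the three vertices of
  \<open>T\<close>.\<close>

lemma card_newly_free_le:
  assumes G: "G \<subseteq> complete_graph n" and T: "T \<in> triangles G"
  shows "card (newly_free G T) \<le> 3 * n"
proof -
  interpret simple_graph G by (rule simple_graph_complete[OF G])
  have "newly_free G T \<subseteq> (\<lambda>(x, y). {x, y}) ` (T \<times> {..<n})"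
  proof
    fix e assume e: "e \<in> newly_free G T"
    then have "e \<in> complete_graph n" using G by (auto simp: newly_free_def free_edges_def remove_triangle_eq)
    then obtain u v where uv: "u < n" "v < n" "e = {u, v}" by (auto simp: complete_graph_def)
    then have "u \<in> T \<or> v \<in> T" using newly_free_meets[OF e] by auto
    then show "e \<in> (\<lambda>(x, y). {x, y}) ` (T \<times> {..<n})"
      using uv by (auto simp: image_iff insert_commute)
  qed
  moreover have fin: "finite (T \<times> {..<n})"
    using T finite_triangle by auto
  ultimately have "card (newly_free G T) \<le> card (T \<times> {..<n})"
    by (meson card_image_le card_mono finite_imageI le_trans)
  then show ?thesis using triangle_card[OF T] by (simp add: card_cartesian_product)
qed

subsection \<open>The potential\<close>

text \<open>The weight is the solution of \<open>w (x - 3) (1 - 9 / x) = w x\<close>, so that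
  \<open>(Q - E / 3) w E\<close> is a supermartingale for the numbers \<open>Q\<close> of triangles and \<open>E\<close> of edges.
  The additive constant in the potential keeps it nonnegative up to the step in which the number of
  free edges first reaches \<open>F\<close>; one step frees at most \<open>3 n\<close> edges.\<close>

definition weight :: "real \<Rightarrow> real" where
  "weight x = 1 / (x * (x - 3) * (x - 6))"

definition potential :: "real \<Rightarrow> real \<Rightarrow> nat \<Rightarrow> nat \<Rightarrow> graph \<Rightarrow> real" where
  "potential D F n m G =
     3 * real (card (isolated_triangles G)) - 9 * D * real (card (free_edges G))
     + 18 * (real (card (triangles G)) - real (card G) / 3) * (weight (card G) / weight m)
     + (9 * D + 7) * (F + 3 * real n)"

lemma weight_pos: "x > 6 \<Longrightarrow> weight x > 0"
  by (simp add: weight_def)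

lemma weight_step:
  assumes "x > 9" shows "weight (x - 3) * (1 - 9 / x) = weight x"
proof -
  have "x - 9 \<noteq> 0" "x \<noteq> 0" using assms by auto
  moreover have "weight (x - 3) = 1 / ((x - 3) * (x - 6) * (x - 9))" by (simp add: weight_def)
  moreover have "1 - 9 / x = (x - 9) / x" using \<open>x \<noteq> 0\<close> by (simp add: field_simps)
  ultimately show ?thesis by (simp add: weight_def)
qed

text \<open>Each factor satisfies \<open>(m - c) / (x - c) <= m / x\<close> because
  \<open>m <= x\<close>. This gives the cubic decay.\<close>

lemma weight_ratio_le:
  assumes "m > 6" "m \<le> x" shows "weight x / weight m \<le> (m / x) ^ 3"
proof -
  have *: "(m - c) / (x - c) \<le> m / x" if "0 \<le> c" "c \<le> 6" for c
  proof -
    have "m * c \<le> x * c" using assms that by (intro mult_right_mono) auto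
    then show ?thesis using assms that by (simp add: field_simps)
  qed
  have "weight x / weight m = m / x * ((m - 3) / (x - 3)) * ((m - 6) / (x - 6))"
    by (simp add: weight_def)
  also have "\<dots> \<le> m / x * (m / x) * (m / x)"
    using assms *[of 3] *[of 6] by (intro mult_mono) auto
  finally show ?thesis by (simp add: power3_eq_cube)
qed

lemma weight_ratio_le_1:
  assumes "m > 6" "m \<le> x" shows "weight x / weight m \<le> 1"
proof -
  have "(m / x) ^ 3 \<le> 1" using assms by (intro power_le_one) auto
  then show ?thesis using weight_ratio_le[OF assms] by linarith
qed

context simple_graph
begin

text \<open>Since \<open>Q - E / 3 >= - f / 3\<close> and the weight ratio is at most 1, the
  negative terms are at least \<open>- (9 D + 6) f\<close>, which the additive constant
  outweighs.\<close>

lemma potential_nonneg: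
  fixes D F :: real
  assumes "card (free_edges G) \<le> F + 3 * real n" "7 \<le> m" "m \<le> card G" "D \<ge> 0"
  shows "potential D F n m G \<ge> 0"
proof -
  define r where "r = weight (card G) / weight m"
  have r: "0 \<le> r" "r \<le> 1"
    using weight_pos[of "card G"] weight_pos[of m] weight_ratio_le_1[of m "card G"] assms
    by (auto simp: r_def)
  let ?f = "real (card (free_edges G))"
  have "(- ?f / 3) * r \<le> (real (card (triangles G)) - real (card G) / 3) * r"
    using card_graph_minus_free_le r by (intro mult_right_mono) auto
  moreover have "?f * r \<le> ?f * 1" using r by (intro mult_left_mono) auto
  moreover have "(9 * D + 7) * ?f \<le> (9 * D + 7) * (F + 3 * real n)"
    using assms by (intro mult_left_mono) auto
  ultimately show ?thesis by (simp add: potential_def r_def[symmetric] algebra_simps)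
qed

text \<open>At \<open>m\<close> edges the weight ratio is 1, so
  \<open>E <= 7 f + 3 I + 18 (Q - E / 3)\<close> applies. The constant absorbs both this
  \<open>7 f\<close> and the subtracted \<open>9 D f\<close>.\<close>

lemma potential_ge:
  fixes D F :: real
  assumes "card (free_edges G) < F" "7 \<le> m" "m = card G" "D \<ge> 0"
  shows "potential D F n m G \<ge> m"
proof -
  let ?f = "real (card (free_edges G))"
  have "weight (card G) / weight m = 1" using weight_pos[of m] assms by simp
  moreover have "(9 * D + 7) * ?f \<le> (9 * D + 7) * (F + 3 * real n)"
    using assms by (intro mult_left_mono) auto
  ultimately show ?thesis
    using card_graph_le_free_isolated assms(3) by (simp add: potential_def algebra_simps)
qed

text \<open>The supermartingale property, with the average over triangles written as a sum. The
  bounds on \<open>m\<close> keep all weights positive and the number of edges above 9.\<close>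

lemma sum_potential_remove_le:
  fixes D F :: real
  assumes D: "\<And>e. e \<in> G \<Longrightarrow> tdeg G e \<le> D" "D \<ge> 0" and m: "7 \<le> m" "m + 3 \<le> card G"
  shows "(\<Sum>T\<in>triangles G. potential D F n m (remove_triangle T G))
    \<le> card (triangles G) * potential D F n m G"
proof -
  let ?E = "real (card G)" and ?Q = "real (card (triangles G))"
  let ?Q' = "\<lambda>T. real (card (triangles (remove_triangle T G)))"
  let ?I = "real (card (isolated_triangles G))" and ?f = "real (card (free_edges G))"
  let ?C = "(9 * D + 7) * (F + 3 * real n)"
  define r where "r = weight ?E / weight m"
  define r' where "r' = weight (?E - 3) / weight m"
  have r': "r' \<ge> 0" "r' * (1 - 9 / ?E) = r"
    using weight_pos[of "?E - 3"] weight_pos[of m] weight_step[of ?E] m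
    by (auto simp: r_def r'_def field_simps)
  have "potential D F n m (remove_triangle T G) \<le>
     (3 * ?I - 9 * D * ?f + ?C) + 3 * (real (card (newly_isolated G T)) - 3 * D * real (card (newly_free G T)))
     + 18 * r' * (?Q' T - (?E - 3) / 3)" if T: "T \<in> triangles G" for T
  proof -
    have E': "real (card (remove_triangle T G)) = ?E - 3" using card_remove_triangle[OF T] by linarith
    then have w: "weight (card (remove_triangle T G)) / weight m = r'" by (simp add: r'_def)
    have "real (card (isolated_triangles (remove_triangle T G))) \<le> ?I + card (newly_isolated G T)"
      using card_isolated_triangles_remove[of T] by linarith
    then show ?thesis
      unfolding potential_def card_free_edges_remove[OF T] w unfolding E' by (simp add: algebra_simps)
  qed
  then have "(\<Sum>T\<in>triangles G. potential D F n m (remove_triangle T G)) \<le>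
     (\<Sum>T\<in>triangles G. (3 * ?I - 9 * D * ?f + ?C)
        + 3 * (real (card (newly_isolated G T)) - 3 * D * real (card (newly_free G T)))
        + 18 * r' * (?Q' T - (?E - 3) / 3))"
    by (rule sum_mono)
  also have "\<dots> = ?Q * (3 * ?I - 9 * D * ?f + ?C)
     + 3 * ((\<Sum>T\<in>triangles G. real (card (newly_isolated G T)))
            - 3 * D * (\<Sum>T\<in>triangles G. real (card (newly_free G T))))
     + 18 * r' * ((\<Sum>T\<in>triangles G. ?Q' T) - ?Q * ((?E - 3) / 3))"
    by (simp add: sum.distrib sum_subtractf flip: sum_distrib_left)
  also have "\<dots> \<le> ?Q * (3 * ?I - 9 * D * ?f + ?C) + 0
     + 18 * r' * (?Q * (?Q + 2 - 9 * ?Q / ?E) - ?Q * ((?E - 3) / 3))"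
  proof -
    have "(\<Sum>T\<in>triangles G. ?Q' T) \<le> ?Q * (?Q + 2 - 9 * ?Q / ?E)"
      using sum_card_triangles_remove m by (simp add: add_ac)
    then have "18 * r' * ((\<Sum>T\<in>triangles G. ?Q' T) - ?Q * ((?E - 3) / 3))
        \<le> 18 * r' * (?Q * (?Q + 2 - 9 * ?Q / ?E) - ?Q * ((?E - 3) / 3))"
      using r'(1) by (intro mult_left_mono) auto
    moreover have "3 * ((\<Sum>T\<in>triangles G. real (card (newly_isolated G T)))
        - 3 * D * (\<Sum>T\<in>triangles G. real (card (newly_free G T)))) \<le> 0"
      using sum_newly_isolated_le[OF D] by auto
    ultimately show ?thesis by (intro add_mono order_refl)
  qed
  \<comment> \<open>The 2 from the triangle count and the 1 from the drop of \<open>E / 3\<close>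
    make 3, which is \<open>9 / E\<close> times \<open>E / 3\<close>; this is why
    \<open>E / 3\<close> is the right centring.\<close>
  also have "?Q * (?Q + 2 - 9 * ?Q / ?E) - ?Q * ((?E - 3) / 3) = ?Q * ((?Q - ?E / 3) * (1 - 9 / ?E))"
    using m by (simp add: field_simps)
  also have "18 * r' * (?Q * ((?Q - ?E / 3) * (1 - 9 / ?E))) = ?Q * (18 * (?Q - ?E / 3) * r)"
    unfolding r'(2)[symmetric] by (simp only: mult_ac)
  finally show ?thesis by (simp add: potential_def r_def algebra_simps)
qed

lemma card_free_edges_remove_le:
  assumes "G \<subseteq> complete_graph n" "T \<in> triangles G"
  shows "card (free_edges (remove_triangle T G)) \<le> card (free_edges G) + 3 * n"
  using card_free_edges_remove[OF assms(2)] card_newly_free_le[OF assms] by simp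

lemma remove_triangle_subset: "remove_triangle T G \<subseteq> G"
  by (auto simp: remove_triangle_def)

end

subsection \<open>The removal process\<close>

lemma prob_bind_pmf_of_set:
  assumes "finite A" "A \<noteq> {}"
  shows "measure_pmf.prob (bind_pmf (pmf_of_set A) f) B = (\<Sum>x\<in>A. measure_pmf.prob (f x) B) / card A"
proof -
  have "emeasure (bind_pmf (pmf_of_set A) f) B = (\<Sum>x\<in>A. emeasure (f x) B) / card A"
    using assms by (simp add: nn_integral_pmf_of_set)
  also have "\<dots> = ennreal ((\<Sum>x\<in>A. measure_pmf.prob (f x) B) / card A)"
    using assms
    by (simp add: measure_pmf.emeasure_eq_measure divide_ennreal sum_nonneg card_gt_0_iff
        ennreal_of_nat_eq_real_of_nat)
  finally show ?thesis
    by (simp add: measure_pmf.emeasure_eq_measure sum_nonneg)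
qed

lemma (in simple_graph) prob_removal_path_Suc:
  assumes "triangles G \<noteq> {}"
  shows "measure_pmf.prob (removal_path (Suc k) G) B =
    (\<Sum>T\<in>triangles G. measure_pmf.prob (removal_path k (remove_triangle T G)) (Cons G -` B))
      / card (triangles G)"
  using assms finite_triangles by (simp add: prob_bind_pmf_of_set)

lemma (in simple_graph) removal_path_Suc_cases:
  assumes "gs \<in> set_pmf (removal_path (Suc k) G)"
  obtains "gs = [G]" "triangles G = {}"
  | T gs' where "T \<in> triangles G" "gs = G # gs'" "gs' \<in> set_pmf (removal_path k (remove_triangle T G))"
  using assms finite_triangles by (auto split: if_splits)

lemma (in simple_graph) removal_path_nonempty:
  assumes "gs \<in> set_pmf (removal_path k G)"
  shows "gs \<noteq> []"
  using assms by (cases k) (auto split: if_splits)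

lemma (in simple_graph) removal_path_nth_0:
  assumes "gs \<in> set_pmf (removal_path k G)"
  shows "gs ! 0 = G"
  using assms by (cases k) (auto elim!: removal_path_Suc_cases simp del: removal_path.simps(2))

text \<open>Optional stopping and Markov's inequality in one induction on \<open>j\<close>, the
  number of steps until exactly \<open>m\<close> edges remain. Once \<open>F\<close> edges are free,
  the event is impossible because free edges never disappear.\<close>

lemma prob_few_free_edges:
  fixes D F :: real
  assumes "G \<subseteq> complete_graph n" "\<And>e. e \<in> G \<Longrightarrow> tdeg G e \<le> D" "D \<ge> 0" "F \<ge> 0"
    "card G = m + 3 * j" "7 \<le> m"
  shows "measure_pmf.prob (removal_path (j + k) G) {gs. j < length gs \<and> card (free_edges (gs ! j)) < F}
    \<le> (if card (free_edges G) < F then potential D F n m G / m else 0)"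
  using assms(1,2,5)
proof (induction j arbitrary: G)
  case 0
  interpret simple_graph G by (rule simple_graph_complete[OF "0.prems"(1)])
  show ?case
  proof (cases "card (free_edges G) < F")
    case True
    then have "m \<le> potential D F n m G" using 0 assms by (intro potential_ge) auto
    then have "1 \<le> potential D F n m G / m" using assms by (simp add: field_simps)
    then show ?thesis using True by (simp add: order_trans[OF measure_pmf.prob_le_1])
  next
    case False
    have "measure_pmf.prob (removal_path k G) {gs. 0 < length gs \<and> card (free_edges (gs ! 0)) < F} = 0"
      using False removal_path_nth_0 by (subst measure_pmf_zero_iff) auto
    then show ?thesis using False by simp
  qed
next
  case (Suc j)
  interpret simple_graph G by (rule simple_graph_complete[OF Suc.prems(1)])
  let ?B = "\<lambda>j. {gs. j < length gs \<and> card (free_edges (gs ! j)) < F}"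
  show ?case
  proof (cases "triangles G = {}")
    case True
    \<comment> \<open>A triangle-free graph ends the run at once, so the event has probability 0 and
      the bound only has to be nonnegative.\<close>
    have "potential D F n m G \<ge> 0" if "card (free_edges G) < F"
      using that Suc.prems assms by (intro potential_nonneg) auto
    then show ?thesis using True by (simp add: measure_return_pmf indicator_def)
  next
    case False
    let ?p = "\<lambda>T. measure_pmf.prob (removal_path (j + k) (remove_triangle T G)) (?B j)"
    have IH: "?p T \<le> (if card (free_edges (remove_triangle T G)) < F
        then potential D F n m (remove_triangle T G) / m else 0)" if T: "T \<in> triangles G" for T
    proof (rule Suc.IH)
      show "remove_triangle T G \<subseteq> complete_graph n" using Suc.prems remove_triangle_subset by blast
      show "card (remove_triangle T G) = m + 3 * j" using card_remove_triangle[OF T] Suc.prems by simp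
      show "tdeg (remove_triangle T G) e \<le> D" if "e \<in> remove_triangle T G" for e
      proof -
        have "e \<in> G" using that remove_triangle_subset by blast
        then show ?thesis using Suc.prems(2)[of e] tdeg_remove_le[of T e] by linarith
      qed
    qed
    have vim: "Cons G -` ?B (Suc j) = ?B j" by auto
    have eq: "measure_pmf.prob (removal_path (Suc j + k) G) (?B (Suc j)) =
        (\<Sum>T\<in>triangles G. ?p T) / card (triangles G)"
      using prob_removal_path_Suc[OF False, of "j + k" "?B (Suc j)"] unfolding vim by simp
    show ?thesis
    proof (cases "card (free_edges G) < F")
      case True
      \<comment> \<open>If this step reaches \<open>F\<close>, the induction hypothesis gives 0, and
        the potential is still nonnegative because at most \<open>3 n\<close> edges were
        freed.\<close>
      have "?p T \<le> potential D F n m (remove_triangle T G) / m" if T: "T \<in> triangles G" for T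
      proof -
        interpret R: simple_graph "remove_triangle T G" by (rule simple_graph_remove)
        have "card (remove_triangle T G) \<ge> m" using card_remove_triangle[OF T] Suc.prems by simp
        moreover have "card (free_edges (remove_triangle T G)) \<le> F + 3 * real n"
          using card_free_edges_remove_le[OF Suc.prems(1) T] True by linarith
        ultimately have "potential D F n m (remove_triangle T G) \<ge> 0"
          using assms by (intro R.potential_nonneg) auto
        then show ?thesis using IH[OF T] by (auto split: if_splits intro: order_trans)
      qed
      then have "(\<Sum>T\<in>triangles G. ?p T) \<le> (\<Sum>T\<in>triangles G. potential D F n m (remove_triangle T G)) / m"
        unfolding sum_divide_distrib by (rule sum_mono)
      also have "\<dots> \<le> card (triangles G) * potential D F n m G / m"
        using Suc.prems assms by (intro divide_right_mono sum_potential_remove_le) auto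
      finally show ?thesis
        using True False finite_triangles unfolding eq by (simp add: field_simps card_gt_0_iff)
    next
      case nF: False
      have "?p T \<le> 0" if T: "T \<in> triangles G" for T
      proof -
        have "card (free_edges G) \<le> card (free_edges (remove_triangle T G))"
          using card_free_edges_remove[OF T] by simp
        then have "\<not> card (free_edges (remove_triangle T G)) < F" using nF by linarith
        then show ?thesis using IH[OF T] by simp
      qed
      then have "(\<Sum>T\<in>triangles G. ?p T) \<le> 0" by (rule sum_nonpos)
      then show ?thesis using nF unfolding eq by (simp add: divide_nonpos_nonneg)
    qed
  qed
qed

section \<open>Structure of a run and restarting it at a fixed step\<close>

lemma removal_path_nth:
  assumes "G \<subseteq> complete_graph n" "gs \<in> set_pmf (removal_path k G)" "i < length gs"
  shows "gs ! i \<subseteq> G \<and> card (gs ! i) + 3 * i = card G \<and> free_edges (gs ! i) \<subseteq> last gs"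
  using assms
proof (induction k arbitrary: G gs i)
  case 0
  then show ?case by (auto simp: free_edges_def)
next
  case (Suc k)
  interpret simple_graph G by (rule simple_graph_complete[OF Suc.prems(1)])
  show ?case
    using Suc.prems(2)
  proof (cases rule: removal_path_Suc_cases)
    case 1
    then show ?thesis using Suc.prems by (auto simp: free_edges_def)
  next
    case (2 T gs')
    have sub: "remove_triangle T G \<subseteq> complete_graph n" using Suc.prems remove_triangle_subset by blast
    have ne: "gs' \<noteq> []" and hd: "gs' ! 0 = remove_triangle T G"
      using simple_graph.removal_path_nonempty[OF simple_graph_remove 2(3)]
        simple_graph.removal_path_nth_0[OF simple_graph_remove 2(3)] by auto
    show ?thesis
    proof (cases i)
      case 0
      have "free_edges (gs' ! 0) \<subseteq> last gs'" using Suc.IH[OF sub 2(3), of 0] ne by auto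
      then show ?thesis using free_edges_mono[OF 2(1)] hd 0 2(2) ne by auto
    next
      case (Suc i')
      then show ?thesis
        using Suc.IH[OF sub 2(3), of i'] Suc.prems(3) 2(2) ne card_remove_triangle[OF 2(1)]
          remove_triangle_subset[of T]
        by auto
    qed
  qed
qed

text \<open>A run that uses all \<open>k\<close> steps lists \<open>k + 1\<close> graphs, so a
  shorter list has stopped for lack of triangles.\<close>

lemma removal_path_last:
  assumes "G \<subseteq> complete_graph n" "gs \<in> set_pmf (removal_path k G)" "length gs \<le> k"
  shows "triangles (last gs) = {}"
  using assms
proof (induction k arbitrary: G gs)
  case 0
  then show ?case by auto
next
  case (Suc k)
  interpret simple_graph G by (rule simple_graph_complete[OF Suc.prems(1)])
  show ?case
    using Suc.prems(2)
  proof (cases rule: removal_path_Suc_cases)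
    case 1
    then show ?thesis by simp
  next
    case (2 T gs')
    have sub: "remove_triangle T G \<subseteq> complete_graph n" using Suc.prems remove_triangle_subset by blast
    show ?thesis
      using Suc.IH[OF sub 2(3)] simple_graph.removal_path_nonempty[OF simple_graph_remove 2(3)] 2(2) Suc.prems(3) by simp
  qed
qed

text \<open>The Markov property: after \<open>i\<close> steps the run continues like a fresh one
  from the graph reached.\<close>

lemma prob_removal_path_split:
  assumes "H \<subseteq> complete_graph n" "\<beta> \<ge> 0"
    and "\<And>G. G \<subseteq> complete_graph n \<Longrightarrow> P G \<Longrightarrow> measure_pmf.prob (removal_path k G) {gs. R (last gs)} \<le> \<beta>"
  shows "measure_pmf.prob (removal_path (i + k) H) {gs. i < length gs \<and> P (gs ! i) \<and> R (last gs)} \<le> \<beta>"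
  using assms(1)
proof (induction i arbitrary: H)
  case 0
  interpret simple_graph H by (rule simple_graph_complete[OF "0.prems"])
  show ?case
  proof (cases "P H")
    case True
    have "measure_pmf.prob (removal_path k H) {gs. 0 < length gs \<and> P (gs ! 0) \<and> R (last gs)}
        \<le> measure_pmf.prob (removal_path k H) {gs. R (last gs)}"
      by (intro measure_pmf.finite_measure_mono) auto
    then show ?thesis using assms(3)[OF 0 True] by simp
  next
    case False
    then have "measure_pmf.prob (removal_path k H) {gs. 0 < length gs \<and> P (gs ! 0) \<and> R (last gs)} = 0"
      using removal_path_nth_0 by (subst measure_pmf_zero_iff) auto
    then show ?thesis using assms(2) by simp
  qed
next
  case (Suc i)
  interpret simple_graph H by (rule simple_graph_complete[OF Suc.prems(1)])
  let ?B = "\<lambda>i. {gs. i < length gs \<and> P (gs ! i) \<and> R (last gs)}"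
  show ?case
  proof (cases "triangles H = {}")
    case True
    then show ?thesis using assms(2) by (simp add: measure_return_pmf indicator_def)
  next
    case False
    have vim: "Cons H -` ?B (Suc i) = ?B i" by auto
    let ?p = "\<lambda>T. measure_pmf.prob (removal_path (i + k) (remove_triangle T H)) (?B i)"
    have "(\<Sum>T\<in>triangles H. ?p T) \<le> card (triangles H) * \<beta>"
      using Suc.prems remove_triangle_subset by (intro sum_bounded_above Suc.IH) blast
    then have "(\<Sum>T\<in>triangles H. ?p T) / card (triangles H) \<le> \<beta>"
      using False finite_triangles by (simp add: divide_le_eq card_gt_0_iff mult.commute)
    then show ?thesis
      using prob_removal_path_Suc[OF False, of "i + k" "?B (Suc i)"] unfolding vim by simp
  qed
qed

lemma prob_last_small:
  fixes D F :: real
  assumes G: "G \<subseteq> complete_graph n" and D: "\<And>e. e \<in> G \<Longrightarrow> tdeg G e \<le> D" "D \<ge> 0"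
    and iso: "isolated_triangles G = {}" and F: "F \<ge> 0" "F \<le> m"
    and m: "card G = m + 3 * j" "7 \<le> m" "j \<le> k"
  shows "measure_pmf.prob (removal_path k G) {gs. card (last gs) < F}
    \<le> 6 * D * (real m)\<^sup>2 / (real (card G))\<^sup>2 + (9 * D + 7) * (F + 3 * real n) / m"
proof -
  interpret simple_graph G by (rule simple_graph_complete[OF G])
  let ?r = "weight (card G) / weight m" and ?E = "real (card G)" and ?Q = "real (card (triangles G))"
  obtain k' where k': "k = j + k'" using m(3) le_Suc_ex by blast
  have E: "?E > 0" "real m \<le> ?E" using m by auto
  \<comment> \<open>A run ending below \<open>F <= m\<close> edges loses three edges per step and so
    passes through exactly \<open>m\<close> edges at index \<open>j\<close>; the edges free at that
    moment all survive to the end.\<close>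
  have "{gs. card (last gs) < F} \<inter> set_pmf (removal_path k G)
      \<subseteq> {gs. j < length gs \<and> card (free_edges (gs ! j)) < F}"
  proof
    fix gs assume "gs \<in> {gs. card (last gs) < F} \<inter> set_pmf (removal_path k G)"
    then have gs: "card (last gs) < F" "gs \<in> set_pmf (removal_path k G)" by auto
    have ne: "gs \<noteq> []" by (rule removal_path_nonempty[OF gs(2)])
    have last: "last gs = gs ! (length gs - 1)" using ne by (rule last_conv_nth)
    have L: "last gs \<subseteq> G" "card (last gs) + 3 * (length gs - 1) = card G"
      using removal_path_nth[OF G gs(2), of "length gs - 1"] ne unfolding last by auto
    have "j < length gs"
    proof (rule ccontr)
      assume "\<not> j < length gs"
      then have "m \<le> card (last gs)" using L(2) m(1) by linarith
      then show False using gs(1) F(2) by linarith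
    qed
    moreover have "card (free_edges (gs ! j)) \<le> card (last gs)"
      using removal_path_nth[OF G gs(2) \<open>j < length gs\<close>] finite_subset[OF L(1) finite_graph]
      by (intro card_mono) auto
    ultimately show "gs \<in> {gs. j < length gs \<and> card (free_edges (gs ! j)) < F}"
      using gs(1) by auto
  qed
  then have "measure_pmf.prob (removal_path k G) {gs. card (last gs) < F}
      \<le> measure_pmf.prob (removal_path k G) {gs. j < length gs \<and> card (free_edges (gs ! j)) < F}"
    by (subst measure_Int_set_pmf[symmetric]) (intro measure_pmf.finite_measure_mono, auto)
  also have "\<dots> \<le> (if card (free_edges G) < F then potential D F n m G / m else 0)"
    unfolding k' using assms by (intro prob_few_free_edges) auto
  also have "\<dots> \<le> 6 * D * (real m)\<^sup>2 / ?E\<^sup>2 + (9 * D + 7) * (F + 3 * real n) / m"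
  proof -
    have r: "0 \<le> ?r" "?r \<le> (m / ?E) ^ 3"
      using weight_pos[of ?E] weight_pos[of m] weight_ratio_le[of m ?E] m by auto
    \<comment> \<open>The initial potential: there are no isolated triangles, and the degree bound
      controls the triangle count.\<close>
    have "3 * ?Q \<le> ?E * D"
      using sum_bounded_above[of G "\<lambda>e. real (tdeg G e)" D] D(1) sum_tdeg by simp
    then have "18 * (?Q - ?E / 3) * ?r \<le> 6 * (?E * D) * ?r"
      using r(1) by (intro mult_right_mono) auto
    also have "\<dots> \<le> 6 * (?E * D) * (m / ?E) ^ 3"
      using r(2) D(2) by (intro mult_left_mono) auto
    finally have X: "18 * (?Q - ?E / 3) * ?r \<le> 6 * (?E * D) * (m / ?E) ^ 3" .
    have "potential D F n m G \<le> 18 * (?Q - ?E / 3) * ?r + (9 * D + 7) * (F + 3 * real n)"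
      using iso D(2) by (simp add: potential_def)
    also have "\<dots> \<le> 6 * (?E * D) * (m / ?E) ^ 3 + (9 * D + 7) * (F + 3 * real n)"
      using X by simp
    finally have "potential D F n m G / m \<le> (6 * (?E * D) * (m / ?E) ^ 3 + (9 * D + 7) * (F + 3 * real n)) / m"
      by (intro divide_right_mono) auto
    also have "\<dots> = 6 * D * (real m)\<^sup>2 / ?E\<^sup>2 + (9 * D + 7) * (F + 3 * real n) / m"
      using E m(2) by (simp add: add_divide_distrib power3_eq_cube power2_eq_square)
    finally show ?thesis using D(2) F by simp
  qed
  finally show ?thesis .
qed

text \<open>The triangles on an edge correspond to their third vertices.\<close>

lemma tdeg_eq_codeg:
  assumes G: "G \<subseteq> complete_graph n" and e: "{u, v} \<in> G"
  shows "tdeg G {u, v} = codeg n G u v"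
proof -
  interpret simple_graph G by (rule simple_graph_complete[OF G])
  have uv: "u \<noteq> v" using card_edge[OF e] by auto
  have ne: "x \<noteq> y" if "{x, y} \<in> G" for x y using card_edge[OF that] by auto
  have bound: "w < n" if "{x, w} \<in> G" for x w
    using that G by (auto simp: complete_graph_def doubleton_eq_iff)
  let ?W = "{w. w < n \<and> {u, w} \<in> G \<and> {v, w} \<in> G}"
  have "{T \<in> triangles G. {u, v} \<subseteq> T} = (\<lambda>w. {u, v, w}) ` ?W"
  proof (intro equalityI subsetI)
    fix T assume "T \<in> {T \<in> triangles G. {u, v} \<subseteq> T}"
    then have T: "T \<in> triangles G" "u \<in> T" "v \<in> T" by auto
    have "card (T - {u, v}) = 1" using T uv triangle_card[OF T(1)] by (simp add: card_Diff_subset)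
    then obtain w where w: "T - {u, v} = {w}" by (rule card_1_singletonE)
    then have "T = {u, v, w}" "w \<noteq> u" "w \<noteq> v" using T by auto
    moreover have "{u, w} \<in> G" "{v, w} \<in> G"
      using triangle_edge[OF T(1)] calculation by auto
    ultimately show "T \<in> (\<lambda>w. {u, v, w}) ` ?W" using bound by blast
  next
    fix T assume "T \<in> (\<lambda>w. {u, v, w}) ` ?W"
    then obtain w where w: "T = {u, v, w}" "{u, w} \<in> G" "{v, w} \<in> G" by auto
    have "u \<noteq> w" "v \<noteq> w" using ne w by auto
    then have "card T = 3" using w(1) uv by simp
    then show "T \<in> {T \<in> triangles G. {u, v} \<subseteq> T}"
      using w e by (auto simp: triangles_def insert_commute)
  qed
  moreover have "inj_on (\<lambda>w. {u, v, w}) ?W"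
  proof (rule inj_onI)
    fix x y assume xy: "x \<in> ?W" "y \<in> ?W" "{u, v, x} = {u, v, y}"
    then have "x \<noteq> u" "x \<noteq> v" using ne by auto
    then show "x = y" using xy(3) by auto
  qed
  ultimately show ?thesis by (simp add: tdeg_def codeg_def card_image)
qed

lemma isolated_triangles_empty:
  assumes "G \<subseteq> complete_graph n" "\<And>e. e \<in> G \<Longrightarrow> tdeg G e \<ge> 2"
  shows "isolated_triangles G = {}"
proof -
  interpret simple_graph G by (rule simple_graph_complete[OF assms(1)])
  have "T \<notin> isolated_triangles G" if T: "T \<in> triangles G" for T
  proof -
    have "{e \<in> G. e \<subseteq> T} \<noteq> {}" using card_edges_of_triangle[OF T]
      by (metis card.empty zero_neq_numeral)
    then obtain e where "e \<in> G" "e \<subseteq> T" by auto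
    then show ?thesis using assms(2)[of e] by (auto simp: isolated_triangles_def)
  qed
  then show ?thesis by (auto simp: isolated_triangles_def)
qed

lemma card_complete_graph: "real (card (complete_graph n)) = real n * (real n - 1) / 2"
proof -
  have "complete_graph n = {e. e \<subseteq> {..<n} \<and> card e = 2}"
    by (auto simp: complete_graph_def card_2_iff)
  then have "card (complete_graph n) = n choose 2" by (simp add: n_subsets)
  then show ?thesis
    by (cases n) (auto simp: choose_two real_of_nat_div algebra_simps)
qed

subsection \<open>The final number of edges\<close>

text \<open>The first error term comes from the initial triangle count, the other two from the
  additive constant of the potential: its \<open>F\<close> part and its \<open>3 n\<close> part. The
  last term vanishes in the limit precisely because \<epsilon> is below 1/6.\<close>

lemma prob_triangle_process_bound:
  fixes \<epsilon> d :: real and n :: nat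
  defines "x \<equiv> real n"
  defines "A \<equiv> {gs. \<forall>i < length gs. pt n i \<ge> x powr (-1/2 + \<epsilon>) \<longrightarrow>
      (\<forall>u<n. \<forall>v<n. u \<noteq> v \<longrightarrow>
         \<bar>real (codeg n (gs ! i) u v) - x * (pt n i)^2\<bar> \<le> d * (x * (pt n i)^2))}"
  assumes \<epsilon>: "0 < \<epsilon>" "\<epsilon> < 1/6" and n: "n \<ge> 2" "x powr (2 * \<epsilon>) \<ge> 8" and d: "d \<le> 1/2"
  shows "measure_pmf.prob (triangle_process n) A
      - (1152 * x powr (- 2 * \<epsilon>) + 28 * x powr (- 3 * \<epsilon>) + 84 * x powr (3 * \<epsilon> - 1/2))
    \<le> measure_pmf.prob (triangle_process n) {gs. real (card (last gs)) \<ge> x powr (3/2 - 6 * \<epsilon>)}"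
proof -
  have x: "x \<ge> 2" using n by (simp add: x_def)
  define y where "y = x powr (2 * \<epsilon>)"
  define p0 where "p0 = x powr (-1/2 + \<epsilon>)"
  \<comment> \<open>The last index at which \<open>pt\<close> is still at least
    \<open>p0\<close>.\<close>
  define i0 where "i0 = nat \<lfloor>(1 - p0) * x\<^sup>2 / 6\<rfloor>"
  define F where "F = x powr (3/2 - 6 * \<epsilon>)"
  \<comment> \<open>The edge count at which the potential is evaluated: smaller than the order of
    the edge count at \<open>i0\<close> by the factor \<open>y\<close>.\<close>
  define M where "M = x powr (3/2 - \<epsilon>)"
  \<comment> \<open>The relative error of at most 1/2 and the rounding of \<open>i0\<close> give
    \<open>3/2 * 49/25 * y\<close>, which is below \<open>3 * y\<close>.\<close>
  define D where "D = 3 * y"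
  let ?K = "complete_graph n"
  let ?\<beta> = "1152 * x powr (- 2 * \<epsilon>) + 28 * x powr (- 3 * \<epsilon>) + 84 * x powr (3 * \<epsilon> - 1/2)"
  define P where "P G \<longleftrightarrow> card G + 3 * i0 = card ?K \<and> (\<forall>e\<in>G. 2 \<le> tdeg G e \<and> tdeg G e \<le> D)" for G
  have y8: "y \<ge> 8" using n by (simp add: y_def)
  have p0: "0 < p0" "p0 \<le> 1"
    using x \<epsilon> powr_mono[of "-1/2 + \<epsilon>" 0 x] by (auto simp: p0_def)
  have xp: "x * p0 = x powr (1/2 + \<epsilon>)" "x\<^sup>2 * p0 = x powr (3/2 + \<epsilon>)" "x * p0\<^sup>2 = y"
  proof -
    show "x * p0 = x powr (1/2 + \<epsilon>)"
      using x powr_add[of x 1 "-1/2 + \<epsilon>"] by (simp add: p0_def)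
    show "x\<^sup>2 * p0 = x powr (3/2 + \<epsilon>)"
      using x powr_add[of x 2 "-1/2 + \<epsilon>"] by (simp add: p0_def)
    have "p0\<^sup>2 = x powr (2 * (-1/2 + \<epsilon>))"
      using x by (simp add: p0_def power2_eq_square flip: powr_add)
    then show "x * p0\<^sup>2 = y"
      using x powr_add[of x 1 "2 * (-1/2 + \<epsilon>)"] by (simp add: y_def)
  qed
  have "y \<le> x powr (1/2 + \<epsilon>)" unfolding y_def using x \<epsilon> by (intro powr_mono) auto
  then have xp8: "x * p0 \<ge> 8" using y8 xp(1) by linarith
  have x2p: "x\<^sup>2 * p0 \<ge> 16"
  proof -
    have "x * (x * p0) \<ge> 2 * 8" using x xp8 by (intro mult_mono) auto
    then show ?thesis by (simp add: power2_eq_square)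
  qed
  have i0: "real i0 \<le> (1 - p0) * x\<^sup>2 / 6" "(1 - p0) * x\<^sup>2 / 6 < real i0 + 1"
  proof -
    have "real i0 = of_int \<lfloor>(1 - p0) * x\<^sup>2 / 6\<rfloor>" using p0 by (simp add: i0_def)
    then show "real i0 \<le> (1 - p0) * x\<^sup>2 / 6" "(1 - p0) * x\<^sup>2 / 6 < real i0 + 1"
      by linarith+
  qed
  have i0n: "i0 \<le> n\<^sup>2"
  proof -
    have "(1 - p0) * x\<^sup>2 \<le> 1 * x\<^sup>2" using p0 by (intro mult_right_mono) auto
    then have "6 * real i0 \<le> real (n\<^sup>2)" using i0(1) by (simp add: x_def)
    then show ?thesis by linarith
  qed
  have pt_ge: "pt n i \<ge> p0" if "i \<le> i0" for i
  proof -
    have "6 * real i \<le> (1 - p0) * x\<^sup>2" using i0(1) that by simp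
    then show ?thesis using x by (simp add: pt_def x_def[symmetric] field_simps)
  qed
  \<comment> \<open>Rounding \<open>i0\<close> down costs at most \<open>6 / x^2\<close>, which is
    at most \<open>2/5 * p0\<close> because \<open>x^2 * p0 >= 16\<close>.\<close>
  have pt_le: "pt n i0 \<le> 7/5 * p0"
  proof -
    have "1 - 6 * real i0 / X \<le> p0 + 6 / X" if "(1 - p0) * X < 6 * real i0 + 6" "X > 0" for X
    proof -
      have "(X - 6 * real i0) / X \<le> (p0 * X + 6) / X"
        using that by (intro divide_right_mono) (auto simp: algebra_simps)
      then show ?thesis using that by (simp add: diff_divide_distrib add_divide_distrib)
    qed
    from this[of "x\<^sup>2"] have "pt n i0 \<le> p0 + 6 / x\<^sup>2"
      using i0(2) x by (simp add: pt_def x_def[symmetric])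
    moreover have "6 / x\<^sup>2 \<le> 2/5 * p0" using x2p x by (simp add: field_simps)
    ultimately show ?thesis by linarith
  qed
  have codeg_ge: "codeg n (gs ! i) u v \<ge> y / 2"
    if "gs \<in> A" "i < length gs" "i \<le> i0" "u < n" "v < n" "u \<noteq> v" for gs i u v
  proof -
    have "\<bar>real (codeg n (gs ! i) u v) - x * (pt n i)^2\<bar> \<le> d * (x * (pt n i)^2)"
      using that pt_ge[OF that(3)] by (auto simp: A_def p0_def)
    moreover have "d * (x * (pt n i)^2) \<le> 1/2 * (x * (pt n i)^2)"
      using x d by (intro mult_right_mono) auto
    moreover have "x * p0\<^sup>2 \<le> x * (pt n i)^2"
      using pt_ge[OF that(3)] p0 x by (intro mult_left_mono power_mono) auto
    ultimately show ?thesis using xp(3) by linarith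
  qed
  have codeg_le: "codeg n (gs ! i0) u v \<le> D"
    if "gs \<in> A" "i0 < length gs" "u < n" "v < n" "u \<noteq> v" for gs u v
  proof -
    have "\<bar>real (codeg n (gs ! i0) u v) - x * (pt n i0)^2\<bar> \<le> d * (x * (pt n i0)^2)"
      using that pt_ge[of i0] by (auto simp: A_def p0_def)
    moreover have "d * (x * (pt n i0)^2) \<le> 1/2 * (x * (pt n i0)^2)"
      using x d by (intro mult_right_mono) auto
    moreover have "x * (pt n i0)^2 \<le> x * (7/5 * p0)\<^sup>2"
      using pt_ge[of i0] pt_le p0 x by (intro mult_left_mono power_mono) auto
    moreover have "x * (7/5 * p0)\<^sup>2 = 49/25 * y" using xp(3) by (simp add: power2_eq_square)
    ultimately show ?thesis using y8 unfolding D_def by linarith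
  qed
  have card_K: "real (card ?K) = x * (x - 1) / 2" by (simp add: card_complete_graph x_def)
  have card_lower: "x\<^sup>2 * p0 / 4 \<le> c" if "real c + 3 * real i = card ?K" "i \<le> i0" for c i :: nat
  proof -
    have "3 * real i \<le> (1 - p0) * x\<^sup>2 / 2" using i0(1) that(2) by simp
    then have "real c \<ge> x\<^sup>2 * p0 / 2 - x / 2"
      using that(1) card_K by (simp add: algebra_simps power2_eq_square)
    moreover have "x * 2 \<le> x\<^sup>2 * p0"
      using mult_left_mono[of 2 "x * p0" x] xp8 x by (simp add: power2_eq_square)
    ultimately show ?thesis by simp
  qed
  have edge: "\<exists>u v. u < n \<and> v < n \<and> u \<noteq> v \<and> e = {u, v}" if "e \<in> ?K" for e
    using that by (auto simp: complete_graph_def)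
  have reach: "i0 < length gs \<and> P (gs ! i0)"
    if gs: "gs \<in> A" "gs \<in> set_pmf (removal_path (n^2) ?K)" for gs
  proof -
    have ne: "gs \<noteq> []" 
      by (rule simple_graph.removal_path_nonempty[OF simple_graph_complete[OF order_refl] gs(2)])
    have tri: "tdeg (gs ! i) e \<ge> 4" if i: "i < length gs" "i \<le> i0" "e \<in> gs ! i" for i e
    proof -
      have sub: "gs ! i \<subseteq> ?K" using removal_path_nth[OF order_refl gs(2) i(1)] by simp
      then obtain u v where uv: "u < n" "v < n" "u \<noteq> v" "e = {u, v}" using edge i(3) by blast
      then show ?thesis
        using codeg_ge[OF gs(1) i(1,2) uv(1-3)] tdeg_eq_codeg[OF sub, of u v] i(3) y8 by simp
    qed
    \<comment> \<open>A run stopping earlier would end in a triangle-free graph that still has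
      edges, yet every edge has positive degree by the co-degree bound. The step budget cannot be
      the cause, since \<open>i0 <= n^2\<close>.\<close>
    have long: "i0 < length gs"
    proof (rule ccontr)
      assume *: "\<not> i0 < length gs"
      let ?i = "length gs - 1"
      have i: "?i < length gs" "?i \<le> i0" using ne * by (auto simp: Suc_le_eq)
      have "card (gs ! ?i) + 3 * ?i = card ?K" using removal_path_nth[OF order_refl gs(2) i(1)] by simp
      then have "x\<^sup>2 * p0 / 4 \<le> card (gs ! ?i)"
        by (intro card_lower[of _ ?i] i) (simp flip: of_nat_mult of_nat_add)
      then have "card (gs ! ?i) > 0" using x2p by linarith
      then obtain e where e: "e \<in> gs ! ?i" by fastforce
      have "length gs \<le> n\<^sup>2" using * i0n by linarith
      then have "triangles (last gs) = {}" by (rule removal_path_last[OF order_refl gs(2)])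
      then have "triangles (gs ! ?i) = {}" using ne by (simp add: last_conv_nth)
      then show False using tri[OF i e] by (simp add: tdeg_def)
    qed
    have sub: "gs ! i0 \<subseteq> ?K" and card: "card (gs ! i0) + 3 * i0 = card ?K"
      using removal_path_nth[OF order_refl gs(2) long] by auto
    have "tdeg (gs ! i0) e \<le> D" if e: "e \<in> gs ! i0" for e
    proof -
      obtain u v where uv: "u < n" "v < n" "u \<noteq> v" "e = {u, v}" using edge sub e by blast
      then show ?thesis
        using codeg_le[OF gs(1) long uv(1-3)] tdeg_eq_codeg[OF sub, of u v] e by simp
    qed
    then show ?thesis using long card tri[OF long order_refl] unfolding P_def by fastforce
  qed
  have "y \<le> M" unfolding y_def M_def using x \<epsilon> by (intro powr_mono) auto
  then have M8: "M \<ge> 8" using y8 by linarith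
  have FM: "F \<le> M" unfolding F_def M_def using x \<epsilon> by (intro powr_mono) auto
  have yM: "y * M = x\<^sup>2 * p0" unfolding xp(2) y_def M_def by (simp add: add.commute flip: powr_add)
  have after: "measure_pmf.prob (removal_path (n^2 - i0) G) {gs. card (last gs) < F} \<le> ?\<beta>"
    if G: "G \<subseteq> ?K" "P G" for G
  proof -
    let ?E = "card G"
    have cG: "?E + 3 * i0 = card ?K" and deg: "\<And>e. e \<in> G \<Longrightarrow> 2 \<le> tdeg G e \<and> tdeg G e \<le> D"
      using G(2) by (auto simp: P_def)
    have E: "x\<^sup>2 * p0 / 4 \<le> ?E"
      using cG by (intro card_lower[of _ i0]) (simp_all flip: of_nat_mult of_nat_add)
    have "2 * M \<le> y * M / 4" using mult_right_mono[of 8 y M] y8 M8 by simp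
    then have EM: "2 * M \<le> ?E" using E yM by linarith
    define c where "c = nat \<lceil>M\<rceil>"
    have "real c = of_int \<lceil>M\<rceil>" using M8 by (simp add: c_def)
    then have c: "M \<le> c" "c < M + 1" by linarith+
    then have cE: "c \<le> ?E" using EM M8 by linarith
    \<comment> \<open>Three edges go per step, so \<open>m\<close> must agree with the current edge
      count modulo 3; this puts \<open>m\<close> within 2 of the rounded-up
      \<open>M\<close>.\<close>
    define j where "j = (?E - c) div 3"
    define m where "m = ?E - 3 * j"
    have mj: "?E = m + 3 * j" unfolding m_def j_def by linarith
    have "c \<le> m" "m \<le> c + 2" using cE unfolding m_def j_def by linarith+
    then have mM: "M \<le> m" "real m \<le> 2 * M" using c M8 by linarith+
    have "x * (x - 1) \<le> x\<^sup>2" by (simp add: power2_eq_square algebra_simps x_def)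
    then have "x * (x - 1) / 2 \<le> x\<^sup>2" using zero_le_power2[of x] by linarith
    then have "real (card ?K) \<le> real (n\<^sup>2)" unfolding card_K by (simp add: x_def)
    then have "j \<le> n^2 - i0" using cG mj by linarith
    then have "measure_pmf.prob (removal_path (n^2 - i0) G) {gs. card (last gs) < F}
      \<le> 6 * D * (real m)\<^sup>2 / (real ?E)\<^sup>2 + (9 * D + 7) * (F + 3 * real n) / m"
      using G(1) deg isolated_triangles_empty[OF G(1)] mj mM M8 FM y8
      by (intro prob_last_small) (auto simp: D_def F_def)
    also have "\<dots> \<le> ?\<beta>"
    proof -
      have "6 * D * (real m)\<^sup>2 / (real ?E)\<^sup>2 \<le> 6 * D * (2 * M)\<^sup>2 / (x\<^sup>2 * p0 / 4)\<^sup>2"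
        using mM E x2p y8 by (intro frac_le mult_left_mono power_mono) (auto simp: D_def)
      also have "\<dots> = 1152 * (y * M\<^sup>2 / (x powr (3/2 + \<epsilon>))\<^sup>2)"
        unfolding xp(2)[symmetric] by (simp add: D_def power2_eq_square)
      also have "y * M\<^sup>2 / (x powr (3/2 + \<epsilon>))\<^sup>2 = x powr (- 2 * \<epsilon>)"
      proof -
        have "y * M\<^sup>2 = x powr (2 * \<epsilon> + ((3/2 - \<epsilon>) + (3/2 - \<epsilon>)))"
          unfolding y_def M_def power2_eq_square by (simp only: powr_add)
        moreover have "(x powr (3/2 + \<epsilon>))\<^sup>2 = x powr ((3/2 + \<epsilon>) + (3/2 + \<epsilon>))"
          unfolding power2_eq_square by (simp only: powr_add)
        ultimately show ?thesis by (simp flip: powr_diff)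
      qed
      finally have first: "6 * D * (real m)\<^sup>2 / (real ?E)\<^sup>2 \<le> 1152 * x powr (- 2 * \<epsilon>)" .
      have "(9 * D + 7) * (F + 3 * real n) / m \<le> (28 * y) * (F + 3 * x) / M"
      proof (rule frac_le)
        have "9 * D + 7 \<le> 28 * y" "0 \<le> F + 3 * x" using y8 x by (auto simp: D_def F_def)
        then show "(9 * D + 7) * (F + 3 * real n) \<le> (28 * y) * (F + 3 * x)"
          unfolding x_def by (rule mult_right_mono)
        show "0 \<le> (28 * y) * (F + 3 * x)" using y8 x by (auto simp: F_def)
      qed (use mM M8 in auto)
      also have "\<dots> = 28 * (y * F / M) + 84 * (y * x / M)"
        by (simp add: add_divide_distrib distrib_left)
      also have "y * F / M = x powr (- 3 * \<epsilon>)"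
      proof -
        have "y * F = x powr (2 * \<epsilon> + (3/2 - 6 * \<epsilon>))" unfolding y_def F_def by (simp only: powr_add)
        then show ?thesis by (simp add: M_def flip: powr_diff)
      qed
      also have "y * x / M = x powr (3 * \<epsilon> - 1/2)"
      proof -
        have "y * x = x powr (2 * \<epsilon> + 1)" using x by (simp add: y_def powr_add)
        then show ?thesis by (simp add: M_def flip: powr_diff)
      qed
      finally show ?thesis using first by linarith
    qed
    finally show ?thesis .
  qed
  let ?pr = "measure_pmf.prob (triangle_process n)"
  let ?B = "{gs. i0 < length gs \<and> P (gs ! i0) \<and> card (last gs) < F}" and ?S = "{gs. F \<le> card (last gs)}"
  have "?pr ?B \<le> ?\<beta>"
    using prob_removal_path_split[of ?K n ?\<beta> P "n^2 - i0" "\<lambda>G. card G < F" i0] after i0n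
    by (simp add: triangle_process_def)
  moreover have "?pr A \<le> ?pr (?S \<union> ?B)"
  proof -
    have "A \<inter> set_pmf (triangle_process n) \<subseteq> ?S \<union> ?B"
      using reach by (auto simp: triangle_process_def)
    then show ?thesis
      by (subst measure_Int_set_pmf[symmetric]) (intro measure_pmf.finite_measure_mono, auto)
  qed
  moreover have "?pr (?S \<union> ?B) \<le> ?pr ?S + ?pr ?B" by (intro measure_Un_le) auto
  ultimately show ?thesis by (simp add: F_def)
qed

theorem theorem6p1:
  fixes \<epsilon> :: real
  assumes "0 < \<epsilon>" and "\<epsilon> < 1/6"
    and "\<exists>\<delta> :: nat \<Rightarrow> real. \<delta> \<longlonglongrightarrow> 0 \<and>
          (\<lambda>n. measure_pmf.prob (triangle_process n)
             {gs. \<forall>i < length gs. pt n i \<ge> real n powr (-1/2 + \<epsilon>) \<longrightarrow>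
                  (\<forall>u<n. \<forall>v<n. u \<noteq> v \<longrightarrow>
                     \<bar>real (codeg n (gs ! i) u v) - real n * (pt n i)^2\<bar>
                       \<le> \<delta> n * (real n * (pt n i)^2))}) \<longlonglongrightarrow> 1"
  shows "\<exists>\<eta> :: nat \<Rightarrow> real. \<eta> \<longlonglongrightarrow> 0 \<and>
          (\<lambda>n. measure_pmf.prob (triangle_process n)
             {gs. real (card (last gs)) \<ge> real n powr (3/2 - 6 * \<epsilon> - \<eta> n)}) \<longlonglongrightarrow> 1"
proof -
  define A where "A d n = {gs. \<forall>i < length gs. pt n i \<ge> real n powr (-1/2 + \<epsilon>) \<longrightarrow>
      (\<forall>u<n. \<forall>v<n. u \<noteq> v \<longrightarrow>
         \<bar>real (codeg n (gs ! i) u v) - real n * (pt n i)^2\<bar> \<le> d * (real n * (pt n i)^2))}" for d n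
  obtain \<delta> :: "nat \<Rightarrow> real" where \<delta>: "\<delta> \<longlonglongrightarrow> 0"
    and lim: "(\<lambda>n. measure_pmf.prob (triangle_process n) (A (\<delta> n) n)) \<longlonglongrightarrow> 1"
    using assms(3) unfolding A_def by blast
  define \<beta> where "\<beta> n = 1152 * real n powr (- 2 * \<epsilon>) + 28 * real n powr (- 3 * \<epsilon>)
    + 84 * real n powr (3 * \<epsilon> - 1/2)" for n
  have powr_lim: "(\<lambda>n. c * real n powr s) \<longlonglongrightarrow> 0" if "s < 0" for c s :: real
    using tendsto_neg_powr[OF that filterlim_real_sequentially] by (rule tendsto_mult_right_zero)
  have "\<beta> \<longlonglongrightarrow> 0 + 0 + 0"
    unfolding \<beta>_def using assms(1,2) by (intro tendsto_add powr_lim) auto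
  then have "(\<lambda>n. measure_pmf.prob (triangle_process n) (A (\<delta> n) n) - \<beta> n) \<longlonglongrightarrow> 1 - 0"
    by (intro tendsto_diff lim) simp
  then have lower: "(\<lambda>n. measure_pmf.prob (triangle_process n) (A (\<delta> n) n) - \<beta> n) \<longlonglongrightarrow> 1" by simp
  have le: "eventually (\<lambda>n. measure_pmf.prob (triangle_process n) (A (\<delta> n) n) - \<beta> n
      \<le> measure_pmf.prob (triangle_process n) {gs. real (card (last gs)) \<ge> real n powr (3/2 - 6 * \<epsilon>)})
      sequentially"
  proof -
    have "eventually (\<lambda>n. 1 * real n powr (- 2 * \<epsilon>) < 1/8) sequentially"
      using assms(1) by (intro order_tendstoD(2)[OF powr_lim]) auto
    then have "eventually (\<lambda>n. real n powr (2 * \<epsilon>) \<ge> 8) sequentially"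
      using eventually_gt_at_top[of 0]
      by eventually_elim (simp add: powr_minus field_simps)
    moreover have "eventually (\<lambda>n. \<delta> n < 1/2) sequentially"
      using \<delta> by (rule order_tendstoD) simp
    moreover have "eventually (\<lambda>n::nat. n \<ge> 2) sequentially" by (rule eventually_ge_at_top)
    ultimately show ?thesis
    proof eventually_elim
      case (elim n)
      then show ?case
        using prob_triangle_process_bound[OF assms(1,2), of n "\<delta> n"] unfolding A_def \<beta>_def by simp
    qed
  qed
  have "(\<lambda>n. measure_pmf.prob (triangle_process n)
      {gs. real (card (last gs)) \<ge> real n powr (3/2 - 6 * \<epsilon>)}) \<longlonglongrightarrow> 1"
    by (rule tendsto_sandwich[OF le always_eventually lower tendsto_const])
      (simp add: measure_pmf.prob_le_1)
  \<comment> \<open>No loss in the exponent occurs, so the zero function is a valid witness.\<close>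
  then show ?thesis by (intro exI[of _ "\<lambda>_. 0"]) simp
qed

end
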